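(* Let $T\subset\mathbb R^n$ be a brick and let $f,g:T\to\mathbb R$. (a) If $f$ is K-integrable and $g=f$ Jordan almost everywhere, then $g$ is also K-integrable and $\int_T g=\int_T f$. (b) If $f$ is continuous on a compact Jordan measurable set $C\subset T$ (i.e. $f|_C$ is continuous) and $f$ vanishes on $T\setminus C$, then $f$ is K-integrable. (c) If $A\subset T$ is Jordan measurable, then $\chi_A$ is K-integrable and $\int_T\chi_A$ is equal to the Jordan measure of $A$.
   Context: Fix a positive integer $n$. A brick is a product $I_1\times\cdots\times I_n$ of $n$ bounded (nonempty) intervals (open, closed or half-open, possibly degenerate); its volume $\lambda$ is the product of the lengths of the intervals. A step function on $T$ is a finite linear combination $g=\sum_{j=1}^M c_j\chi_{T_j}$ of characteristic functions of bricks $T_j\subset T$; its integral is $\int_T g=\sum_j c_j\lambda(T_j)$. A sequence of functions $f_m:T\to\mathbb R$ converges nearly uniformly to $f:T\to\mathbb R$ if (i) the sequence $(f_m)$ is uniformly bounded on $T$, and (ii) for every $\delta>0$ there exist finitely many bricks contained in $T$, of total volume less than $\delta$, such that $f_m$ converges uniformly to $f$ on the complement (in $T$) of their union. A function $f:T\to\mathbb R$ is K-integrable if there is a sequence $(g_m)$ of step functions converging nearly uniformly to $f$; its K-integral is then $\int_T f:=\lim_{m\to\infty}\int_T g_m$ (the limit exists and does not depend on the choice of $(g_m)$). A set is a Jordan null set if for each $\varepsilon>0$ it can be covered by finitely many bricks of total volume less than $\varepsilon$; a set is Jordan measurable if it is bounded and its boundary (in $\mathbb R^n$) is a Jordan null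 set. A property holds Jordan almost everywhere if it holds outside a Jordan null set. $\chi_A$ denotes the characteristic function of $A$ (on $T$). *)

theory Defs
  imports "HOL-Analysis.Analysis"
begin

text \<open>
  Functions on a brick \<open>T\<close> are total functions on \<open>real ^ 'n\<close>; every notion below that takes \<open>T\<close> as
  an argument depends only on their values on \<open>T\<close>.
\<close>

definition brick :: "(real ^ 'n) set \<Rightarrow> bool" where
  "brick B \<longleftrightarrow> (\<exists>I :: 'n \<Rightarrow> real set.
     (\<forall>i. is_interval (I i) \<and> bounded (I i) \<and> I i \<noteq> {}) \<and> B = {x. \<forall>i. x $ i \<in> I i})"

text \<open>
  A brick is nonempty, so its factors are its coordinate projections; the length of a nonempty
  bounded interval is the difference of its supremum and infimum.
\<close>

definition brick_volume :: "(real ^ 'n) set \<Rightarrow> real" where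
  "brick_volume B = (\<Prod>i\<in>UNIV. Sup ((\<lambda>x. x $ i) ` B) - Inf ((\<lambda>x. x $ i) ` B))"

definition step_representation ::
    "(real ^ 'n) set \<Rightarrow> (real ^ 'n \<Rightarrow> real) \<Rightarrow> nat \<Rightarrow> (nat \<Rightarrow> real) \<Rightarrow> (nat \<Rightarrow> (real ^ 'n) set) \<Rightarrow> bool"
  where
  "step_representation T g M c B \<longleftrightarrow>
     (\<forall>j<M. brick (B j) \<and> B j \<subseteq> T) \<and> (\<forall>x\<in>T. g x = (\<Sum>j<M. c j * indicat_real (B j) x))"

definition step_function :: "(real ^ 'n) set \<Rightarrow> (real ^ 'n \<Rightarrow> real) \<Rightarrow> bool" where
  "step_function T g \<longleftrightarrow> (\<exists>M c B. step_representation T g M c B)"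

text \<open>The sum does not depend on the representation of the step function.\<close>

definition step_integral :: "(real ^ 'n) set \<Rightarrow> (real ^ 'n \<Rightarrow> real) \<Rightarrow> real" where
  "step_integral T g =
     (THE I. \<exists>M c B. step_representation T g M c B \<and> I = (\<Sum>j<M. c j * brick_volume (B j)))"

definition converges_nearly_uniformly ::
    "(real ^ 'n) set \<Rightarrow> (nat \<Rightarrow> real ^ 'n \<Rightarrow> real) \<Rightarrow> (real ^ 'n \<Rightarrow> real) \<Rightarrow> bool" where
  "converges_nearly_uniformly T F f \<longleftrightarrow>
     (\<exists>K. \<forall>m. \<forall>x\<in>T. \<bar>F m x\<bar> \<le> K) \<and>
     (\<forall>\<delta>>0. \<exists>\<B>. finite \<B> \<and> (\<forall>B\<in>\<B>. brick B \<and> B \<subseteq> T) \<and> (\<Sum>B\<in>\<B>. brick_volume B) < \<delta> \<and>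
        uniform_limit (T - \<Union>\<B>) F f sequentially)"

definition K_integrable :: "(real ^ 'n) set \<Rightarrow> (real ^ 'n \<Rightarrow> real) \<Rightarrow> bool" where
  "K_integrable T f \<longleftrightarrow>
     (\<exists>s. (\<forall>m. step_function T (s m)) \<and> converges_nearly_uniformly T s f)"

text \<open>
  For K-integrable \<open>f\<close> the limit exists and is the same for all approximating sequences, so the
  description below determines it; for other \<open>f\<close> the value is unspecified.
\<close>

definition K_integral :: "(real ^ 'n) set \<Rightarrow> (real ^ 'n \<Rightarrow> real) \<Rightarrow> real" where
  "K_integral T f =
     (THE I. \<forall>s. (\<forall>m. step_function T (s m)) \<and> converges_nearly_uniformly T s f \<longrightarrow>
        (\<lambda>m. step_integral T (s m)) \<longlonglongrightarrow> I)"

definition jordan_null :: "(real ^ 'n) set \<Rightarrow> bool" where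
  "jordan_null N \<longleftrightarrow> (\<forall>\<epsilon>>0. \<exists>\<B>. finite \<B> \<and> (\<forall>B\<in>\<B>. brick B) \<and> N \<subseteq> \<Union>\<B> \<and>
     (\<Sum>B\<in>\<B>. brick_volume B) < \<epsilon>)"

definition jordan_measurable :: "(real ^ 'n) set \<Rightarrow> bool" where
  "jordan_measurable A \<longleftrightarrow> bounded A \<and> jordan_null (frontier A)"

definition jordan_ae_on :: "(real ^ 'n) set \<Rightarrow> (real ^ 'n \<Rightarrow> bool) \<Rightarrow> bool" where
  "jordan_ae_on T P \<longleftrightarrow> (\<exists>N. jordan_null N \<and> (\<forall>x\<in>T - N. P x))"

definition outer_jordan_content :: "(real ^ 'n) set \<Rightarrow> real" where
  "outer_jordan_content A =
     Inf {(\<Sum>B\<in>\<B>. brick_volume B) | \<B>. finite \<B> \<and> (\<forall>B\<in>\<B>. brick B) \<and> A \<subseteq> \<Union>\<B>}"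

definition inner_jordan_content :: "(real ^ 'n) set \<Rightarrow> real" where
  "inner_jordan_content A =
     Sup {(\<Sum>B\<in>\<B>. brick_volume B) | \<B>.
       finite \<B> \<and> (\<forall>B\<in>\<B>. brick B) \<and> disjoint \<B> \<and> \<Union>\<B> \<subseteq> A}"

text \<open>
  For a Jordan measurable set the two contents agree, and its Jordan measure is their common value;
  where they differ, the value is unspecified.
\<close>

definition jordan_measure :: "(real ^ 'n) set \<Rightarrow> real" where
  "jordan_measure A = (THE v. inner_jordan_content A = v \<and> outer_jordan_content A = v)"

end

theory Submission
  imports Defs
begin

text \<open>
  The integral of a step function is its Henstock-Kurzweil integral, and nearly uniform convergence is
  bounded convergence outside a negligible set; by dominated convergence the K-integral of a
  K-integrable function is therefore its Henstock-Kurzweil integral. For (a), a step sequence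
  approximating \<open>f\<close> also approximates \<open>g\<close>. For (b) and (c), away from finitely many open bricks of
  small volume covering the frontier of \<open>C\<close>, every point of \<open>C\<close> has uniformly positive distance from
  the complement of \<open>C\<close>. So a function which is uniformly continuous on \<open>C\<close> and vanishes elsewhere is
  approximated there by sampling it on the cells of a fine mesh that lie inside \<open>C\<close>. These cells
  exhaust the Lebesgue measure of \<open>C\<close>, and together with the small bricks they cover \<open>C\<close>, so both
  Jordan contents equal the Lebesgue measure.
\<close>

section \<open>Bricks and their volume\<close>

text \<open>The corners are the infima and suprema of the factors. A number strictly between these
  lies between two members of its factor, so it belongs to the interval. Every mix of open, closed
  and degenerate factors is thus reduced to boxes with the same corners.\<close>

lemma brick_between_boxes:
  fixes B :: "(real ^ 'n) set"
  assumes "brick B"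
  shows "\<exists>a b. (\<forall>i. a $ i \<le> b $ i) \<and> box a b \<subseteq> B \<and> B \<subseteq> cbox a b \<and>
    brick_volume B = (\<Prod>i\<in>UNIV. b $ i - a $ i)"
proof -
  obtain I where "\<forall>i. is_interval (I i) \<and> bounded (I i) \<and> I i \<noteq> {}"
    and B: "B = {x. \<forall>i. x $ i \<in> I i}"
    using assms unfolding brick_def by (elim exE conjE)
  then have I: "is_interval (I i)" "bounded (I i)" "I i \<noteq> {}" for i
    by auto
  define a b :: "real ^ 'n" where "a = (\<chi> i. Inf (I i))" and "b = (\<chi> i. Sup (I i))"
  have bd: "bdd_below (I i)" "bdd_above (I i)" for i
    using bounded_imp_bdd_below[OF I(2)] bounded_imp_bdd_above[OF I(2)] by auto
  have "box a b \<subseteq> B"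
  proof
    fix x assume x: "x \<in> box a b"
    have "x $ i \<in> I i" for i
    proof -
      have "Inf (I i) < x $ i" "x $ i < Sup (I i)"
        using x by (auto simp: mem_box_cart a_def b_def)
      then obtain u v where "u \<in> I i" "u \<le> x $ i" "v \<in> I i" "x $ i \<le> v"
        unfolding cInf_less_iff[OF I(3) bd(1)] less_cSup_iff[OF I(3) bd(2)]
        by (auto intro: less_imp_le)
      then show ?thesis
        using I(1)[of i] unfolding is_interval_1 by blast
    qed
    then show "x \<in> B" by (simp add: B)
  qed
  moreover have "B \<subseteq> cbox a b"
    by (auto simp: B mem_box_cart a_def b_def intro!: cInf_lower[OF _ bd(1)] cSup_upper[OF _ bd(2)])
  moreover have "(\<lambda>x. x $ i) ` B = I i" for i
  proof
    show "I i \<subseteq> (\<lambda>x. x $ i) ` B"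
    proof
      \<comment> \<open>Every factor is nonempty, so any \<open>t\<close> in factor \<open>i\<close>
        extends to a point of \<open>B\<close> by choosing the other coordinates freely.\<close>
      fix t assume t: "t \<in> I i"
      have "(\<chi> j. if j = i then t else (SOME s. s \<in> I j)) \<in> B"
        using t I(3) by (simp add: B some_in_eq)
      then show "t \<in> (\<lambda>x. x $ i) ` B"
        by (rule rev_image_eqI) simp
    qed
  qed (auto simp: B)
  then have "brick_volume B = (\<Prod>i\<in>UNIV. b $ i - a $ i)"
    by (simp add: brick_volume_def a_def b_def)
  moreover have "a $ i \<le> b $ i" for i
    using cInf_le_cSup[OF I(3) bd(2) bd(1)] by (simp add: a_def b_def)
  ultimately show ?thesis by blast
qed

lemma brick_bounded: "brick B \<Longrightarrow> bounded B"
  using brick_between_boxes bounded_subset[OF bounded_cbox] by blast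

lemma brick_volume_nonneg: "brick B \<Longrightarrow> 0 \<le> brick_volume B"
  by (drule brick_between_boxes) (auto intro!: prod_nonneg)

text \<open>\<open>B\<close> differs from \<open>cbox a b\<close> only inside the frontier of the
  box, which is negligible. Monotonicity, subadditivity and additivity of brick volumes can then be
  inherited from Lebesgue measure.\<close>

lemma brick_lmeasurable_and_measure:
  assumes "brick B"
  shows "B \<in> lmeasurable \<and> measure lebesgue B = brick_volume B"
proof -
  obtain a b where ab: "\<forall>i. a $ i \<le> b $ i" "box a b \<subseteq> B" "B \<subseteq> cbox a b"
    "brick_volume B = (\<Prod>i\<in>UNIV. b $ i - a $ i)"
    using brick_between_boxes[OF assms] by blast
  have "negligible (cbox a b - B \<union> (B - cbox a b))"
    by (rule negligible_subset[OF negligible_frontier_interval[of a b]]) (use ab in auto)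
  then have "B \<in> lmeasurable" "measure lebesgue B = measure lebesgue (cbox a b)"
    using lmeasurable_negligible_symdiff[of "cbox a b" B] measure_negligible_symdiff[of "cbox a b" B]
    by (auto simp: lmeasurable_cbox)
  moreover have "cbox a b \<noteq> {}"
    using ab(1) by (simp add: interval_ne_empty_cart)
  ultimately show ?thesis
    using ab(4) by (simp add: content_cbox_cart)
qed

lemmas brick_lmeasurable = brick_lmeasurable_and_measure [THEN conjunct1]
  and measure_brick = brick_lmeasurable_and_measure [THEN conjunct2]

lemma brick_Int:
  assumes "brick A" "brick B" "A \<inter> B \<noteq> {}"
  shows "brick (A \<inter> B)"
proof -
  obtain I where I: "\<forall>i. is_interval (I i) \<and> bounded (I i) \<and> I i \<noteq> {}" "A = {x. \<forall>i. x $ i \<in> I i}"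
    using assms(1) unfolding brick_def by (elim exE conjE)
  obtain J where J: "\<forall>i. is_interval (J i) \<and> bounded (J i) \<and> J i \<noteq> {}" "B = {x. \<forall>i. x $ i \<in> J i}"
    using assms(2) unfolding brick_def by (elim exE conjE)
  have "A \<inter> B = {x. \<forall>i. x $ i \<in> I i \<inter> J i}"
    using I J by blast
  moreover have "I i \<inter> J i \<noteq> {}" for i
    using assms(3) I J by blast
  ultimately show ?thesis
    unfolding brick_def using I(1) J(1)
    by (intro exI[of _ "\<lambda>i. I i \<inter> J i"]) (auto intro: is_interval_Int bounded_Int)
qed

lemma brick_volume_mono:
  assumes "brick A" "brick B" "A \<subseteq> B"
  shows "brick_volume A \<le> brick_volume B"
  using measure_mono_fmeasurable[OF assms(3) fmeasurableD[OF brick_lmeasurable] brick_lmeasurable]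
  by (simp add: measure_brick assms)

text \<open>Widening the enclosing box by \<open>t\<close> on every side gives a volume that is a
  polynomial in \<open>t\<close>, hence continuous at 0. A strictly positive \<open>t\<close> puts
  even degenerate or closed factors inside an open interval.\<close>

lemma brick_open_superset:
  fixes B :: "(real ^ 'n) set"
  assumes "brick B" "e > 0"
  obtains B' where "brick B'" "open B'" "B \<subseteq> B'" "brick_volume B' < brick_volume B + e"
proof -
  obtain a b :: "real ^ 'n" where ab: "\<forall>i. a $ i \<le> b $ i" "box a b \<subseteq> B" "B \<subseteq> cbox a b"
    "brick_volume B = (\<Prod>i\<in>UNIV. b $ i - a $ i)"
    using brick_between_boxes[OF assms(1)] by blast
  have "((\<lambda>t. \<Prod>i\<in>UNIV. (b $ i + t) - (a $ i - t)) \<longlongrightarrow>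
          (\<Prod>i\<in>UNIV. (b $ i + 0) - (a $ i - 0))) (at_right 0)"
    by (intro tendsto_intros)
  then have "\<forall>\<^sub>F t in at_right 0. (\<Prod>i\<in>UNIV. (b $ i + t) - (a $ i - t)) < brick_volume B + e"
    by (rule order_tendstoD) (use ab assms in simp)
  then have "\<forall>\<^sub>F t in at_right 0. 0 < t \<and> (\<Prod>i\<in>UNIV. (b $ i + t) - (a $ i - t)) < brick_volume B + e"
    using eventually_at_right_less[of "0::real"] by eventually_elim simp
  then obtain t :: real
    where t: "t > 0" "(\<Prod>i\<in>UNIV. (b $ i + t) - (a $ i - t)) < brick_volume B + e"
    using eventually_happens'[OF trivial_limit_at_right_real] by blast
  define B' where "B' = box (\<chi> i. a $ i - t) (\<chi> i. b $ i + t)"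
  have B': "B' = {x. \<forall>i. x $ i \<in> {a $ i - t<..<b $ i + t}}"
    by (auto simp: B'_def mem_box_cart)
  have lt: "a $ i - t < b $ i + t" for i
    using ab(1)[rule_format, of i] t by linarith
  have "{a $ i - t<..<b $ i + t} \<noteq> {}" for i
    using lt[of i] by auto
  then have "brick B'"
    unfolding brick_def using B'
    by (intro exI[of _ "\<lambda>i. {a $ i - t<..<b $ i + t}"]) (auto simp: is_interval_oo)
  moreover have "brick_volume B' = (\<Prod>i\<in>UNIV. (b $ i + t) - (a $ i - t))"
  proof -
    have "box (\<chi> i. a $ i - t) (\<chi> i. b $ i + t) \<noteq> {}"
      using lt by (simp add: interval_ne_empty_cart)
    then have "cbox (\<chi> i. a $ i - t) (\<chi> i. b $ i + t) \<noteq> {}"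
      using box_subset_cbox by blast
    then show ?thesis
      using measure_brick[OF \<open>brick B'\<close>]
        content_cbox_cart[of "\<chi> i. a $ i - t" "\<chi> i. b $ i + t"]
      by (simp add: B'_def measure_lborel_box_eq measure_lborel_cbox_eq)
  qed
  moreover have "B \<subseteq> B'"
  proof
    fix x assume "x \<in> B"
    then have "a $ i \<le> x $ i" "x $ i \<le> b $ i" for i
      using ab(3) by (auto simp: mem_box_cart)
    then have "a $ i - t < x $ i" "x $ i < b $ i + t" for i
      using t(1) by (meson add_strict_increasing2 diff_less_eq le_less_trans less_add_same_cancel1 less_le_trans)+
    then show "x \<in> B'"
      by (simp add: B')
  qed
  ultimately show ?thesis
    using that[of B'] t(2) by (simp add: B'_def open_box)
qed

section \<open>Finite families of bricks and Jordan null sets\<close>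

lemma Union_bricks_lmeasurable:
  assumes "finite \<B>" "\<And>B. B \<in> \<B> \<Longrightarrow> brick B"
  shows "\<Union>\<B> \<in> lmeasurable" "measure lebesgue (\<Union>\<B>) \<le> (\<Sum>B\<in>\<B>. brick_volume B)"
proof -
  show "\<Union>\<B> \<in> lmeasurable"
    using assms brick_lmeasurable by (intro fmeasurable.finite_Union) auto
  have "measure lebesgue (\<Union>\<B>) \<le> (\<Sum>B\<in>\<B>. measure lebesgue B)"
    using assms brick_lmeasurable by (intro measure_Union_le) auto
  also have "\<dots> = (\<Sum>B\<in>\<B>. brick_volume B)"
    using assms measure_brick by (intro sum.cong) auto
  finally show "measure lebesgue (\<Union>\<B>) \<le> (\<Sum>B\<in>\<B>. brick_volume B)" .
qed

lemma jordan_null_imp_negligible: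
  assumes "jordan_null N"
  shows "negligible N"
  unfolding negligible_outer
proof (intro allI impI)
  fix e :: real assume "e > 0"
  then obtain \<B> where "finite \<B>" "\<forall>B\<in>\<B>. brick B" "N \<subseteq> \<Union>\<B>" "(\<Sum>B\<in>\<B>. brick_volume B) < e"
    using assms[unfolded jordan_null_def, rule_format, OF \<open>e > 0\<close>] by blast
  then have "N \<subseteq> \<Union>\<B> \<and> \<Union>\<B> \<in> lmeasurable \<and> measure lebesgue (\<Union>\<B>) < e"
    using Union_bricks_lmeasurable[of \<B>] by (meson le_less_trans)
  then show "\<exists>T. N \<subseteq> T \<and> T \<in> lmeasurable \<and> measure lebesgue T < e" ..
qed

lemma jordan_measurable_imp_lmeasurable: "jordan_measurable A \<Longrightarrow> A \<in> lmeasurable"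
  unfolding jordan_measurable_def by (auto intro: measurable_Jordan jordan_null_imp_negligible)

text \<open>Null covers may leave \<open>T\<close>, whereas the exceptional bricks of nearly uniform
  convergence may not; this cuts the former down to the latter. Empty traces are dropped because a
  brick is nonempty.\<close>

lemma bricks_restrict:
  assumes "brick T" "finite \<B>" "\<And>B. B \<in> \<B> \<Longrightarrow> brick B"
  obtains \<B>' where "finite \<B>'" "\<And>B. B \<in> \<B>' \<Longrightarrow> brick B \<and> B \<subseteq> T" "\<Union>\<B>' = T \<inter> \<Union>\<B>"
    "(\<Sum>B\<in>\<B>'. brick_volume B) \<le> (\<Sum>B\<in>\<B>. brick_volume B)"
proof
  let ?S = "{B \<in> \<B>. T \<inter> B \<noteq> {}}"
  let ?\<B> = "(\<inter>) T ` ?S"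
  show "finite ?\<B>" "\<Union>?\<B> = T \<inter> \<Union>\<B>"
    using assms(2) by auto
  have b: "brick (T \<inter> B)" if "B \<in> ?S" for B
    using that assms by (intro brick_Int) auto
  then show "brick B \<and> B \<subseteq> T" if "B \<in> ?\<B>" for B
    using that by blast
  \<comment> \<open>Different bricks can have the same trace on \<open>T\<close>, so passing to the
    set of traces gives an inequality only.\<close>
  have "(\<Sum>B\<in>?\<B>. brick_volume B) \<le> (\<Sum>B\<in>?S. brick_volume (T \<inter> B))"
    using sum_image_le[of ?S brick_volume "(\<inter>) T"] brick_volume_nonneg[OF b] assms(2)
    by (simp add: o_def)
  also have "\<dots> \<le> (\<Sum>B\<in>?S. brick_volume B)"
  proof (rule sum_mono)
    fix B assume "B \<in> ?S"
    then show "brick_volume (T \<inter> B) \<le> brick_volume B"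
      using brick_volume_mono[OF b] assms(3) by simp
  qed
  also have "\<dots> \<le> (\<Sum>B\<in>\<B>. brick_volume B)"
    by (rule sum_mono2) (use assms brick_volume_nonneg in auto)
  finally show "(\<Sum>B\<in>?\<B>. brick_volume B) \<le> (\<Sum>B\<in>\<B>. brick_volume B)" .
qed

section \<open>The K-integral as a Henstock-Kurzweil integral\<close>

text \<open>The indicator of a brick in \<open>T\<close> integrates to its measure, and the rest is
  linearity. Since an integral is unique, the sum is the same for all representations, which makes
  the description in \<open>step_integral\<close> meaningful.\<close>

lemma step_representation_has_integral:
  assumes "step_representation T g M c B"
  shows "(g has_integral (\<Sum>j<M. c j * brick_volume (B j))) T"
proof -
  have B: "brick (B j)" "B j \<subseteq> T" if "j < M" for j
    using assms that unfolding step_representation_def by auto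
  have "(indicat_real (B j) has_integral brick_volume (B j)) T" if "j < M" for j
  proof -
    have "B j \<inter> T \<in> lmeasurable" "measure lebesgue (B j \<inter> T) = brick_volume (B j)"
      using B[OF that] brick_lmeasurable measure_brick by (auto simp: Int_absorb2)
    then show ?thesis
      using integral_indicator integrable_on_indicator by (metis has_integral_integral)
  qed
  then have "((\<lambda>x. \<Sum>j<M. c j * indicat_real (B j) x) has_integral
      (\<Sum>j<M. c j * brick_volume (B j))) T"
    by (intro has_integral_sum has_integral_mult_right) auto
  then show ?thesis
    by (rule has_integral_eq[rotated]) (use assms in \<open>auto simp: step_representation_def\<close>)
qed

lemma step_function_has_integral:
  assumes "step_function T g"
  shows "(g has_integral step_integral T g) T"
proof -
  obtain M c B where r: "step_representation T g M c B"
    using assms unfolding step_function_def by blast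
  have "step_integral T g = integral T g"
    unfolding step_integral_def
  proof (rule the_equality)
    show "\<exists>M c B. step_representation T g M c B \<and> integral T g = (\<Sum>j<M. c j * brick_volume (B j))"
      using r step_representation_has_integral by blast
  qed (auto dest!: step_representation_has_integral integral_unique)
  then show ?thesis
    using step_representation_has_integral[OF r] by (metis integral_unique)
qed

text \<open>The uniform bound is a dominating constant, integrable because \<open>T\<close> has
  finite measure, and pointwise convergence fails only on a negligible set. The limit is therefore
  the same for every approximating sequence.\<close>

lemma step_integral_tendsto_integral:
  assumes T: "brick T" and s: "\<And>m. step_function T (s m)" "converges_nearly_uniformly T s f"
  shows "(\<lambda>m. step_integral T (s m)) \<longlonglongrightarrow> integral T f"
proof -
  obtain K where K: "\<And>m x. x \<in> T \<Longrightarrow> \<bar>s m x\<bar> \<le> K"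
    using s(2) unfolding converges_nearly_uniformly_def by blast
  define N where "N = {x \<in> T. \<not> (\<lambda>m. s m x) \<longlonglongrightarrow> f x}"
  have "negligible N"
    unfolding negligible_outer
  proof (intro allI impI)
    fix e :: real assume "e > 0"
    then obtain \<B> where \<B>: "finite \<B>" "\<forall>B\<in>\<B>. brick B" "(\<Sum>B\<in>\<B>. brick_volume B) < e"
      "uniform_limit (T - \<Union>\<B>) s f sequentially"
      using s(2) unfolding converges_nearly_uniformly_def by meson
    \<comment> \<open>Uniform convergence off the bricks implies pointwise convergence there, so
      every bad point lies in a union of arbitrarily small volume.\<close>
    have "N \<subseteq> \<Union>\<B>"
      using tendsto_uniform_limitI[OF \<B>(4)] by (auto simp: N_def)
    then have "N \<subseteq> \<Union>\<B> \<and> \<Union>\<B> \<in> lmeasurable \<and> measure lebesgue (\<Union>\<B>) < e"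
      using Union_bricks_lmeasurable[of \<B>] \<B>(1-3) by (meson le_less_trans)
    then show "\<exists>T. N \<subseteq> T \<and> T \<in> lmeasurable \<and> measure lebesgue T < e" ..
  qed
  \<comment> \<open>\<open>T\<close> and \<open>T - N\<close> differ by a negligible set. On
    \<open>T - N\<close> convergence holds at every point, and the integrals agree with those over
    \<open>T\<close>.\<close>
  then have neg: "negligible {x \<in> T - (T - N). h x \<noteq> 0}" "negligible {x \<in> (T - N) - T. h x \<noteq> 0}"
    for h :: "_ \<Rightarrow> real"
    by (auto intro: negligible_subset)
  have "(\<lambda>m. integral (T - N) (s m)) \<longlonglongrightarrow> integral (T - N) f"
  proof (rule dominated_convergence(2)[where h = "\<lambda>x. K"])
    show "s m integrable_on T - N" for m
      using integrable_spike_set[OF _ neg] step_function_has_integral[OF s(1)] by blast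
    show "(\<lambda>x. K) integrable_on T - N"
      using integrable_spike_set[OF integrable_on_const neg] brick_lmeasurable[OF T] by blast
  qed (use K in \<open>auto simp: N_def\<close>)
  moreover have "integral (T - N) (s m) = step_integral T (s m)" for m
    using integral_spike_set[OF neg] step_function_has_integral[OF s(1)] by (metis integral_unique)
  moreover have "integral (T - N) f = integral T f"
    using integral_spike_set[OF neg] by metis
  ultimately show ?thesis by simp
qed

text \<open>All approximating sequences have the limit \<open>integral T f\<close>. The existence of
  at least one of them makes this the only number satisfying the description.\<close>

lemma K_integral_eq_integral:
  assumes "brick T" "K_integrable T f"
  shows "K_integral T f = integral T f"
proof -
  obtain s where "\<forall>m. step_function T (s m)" "converges_nearly_uniformly T s f"
    using assms(2) unfolding K_integrable_def by blast
  then show ?thesis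
    unfolding K_integral_def using step_integral_tendsto_integral[OF assms(1)]
    by (intro the_equality) (blast intro: LIMSEQ_unique)+
qed

text \<open>The step sequence stays unchanged; only the exceptional family grows, by a cover of the
  set where \<open>g\<close> and \<open>f\<close> differ. Each of the two families gets half of
  \<open>\<delta>\<close>.\<close>

lemma K_integrable_ae_cong:
  assumes T: "brick T" and f: "K_integrable T f" and ae: "jordan_ae_on T (\<lambda>x. g x = f x)"
  shows "K_integrable T g"
proof -
  obtain s where s: "\<And>m. step_function T (s m)" "converges_nearly_uniformly T s f"
    using f unfolding K_integrable_def by blast
  obtain N where N: "jordan_null N" "\<And>x. x \<in> T - N \<Longrightarrow> g x = f x"
    using ae unfolding jordan_ae_on_def by blast
  have "\<exists>\<B>. finite \<B> \<and> (\<forall>B\<in>\<B>. brick B \<and> B \<subseteq> T) \<and> (\<Sum>B\<in>\<B>. brick_volume B) < \<delta> \<and>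
        uniform_limit (T - \<Union>\<B>) s g sequentially" if "\<delta> > 0" for \<delta>
  proof -
    obtain \<B> where \<B>: "finite \<B>" "\<forall>B\<in>\<B>. brick B \<and> B \<subseteq> T" "(\<Sum>B\<in>\<B>. brick_volume B) < \<delta>/2"
      "uniform_limit (T - \<Union>\<B>) s f sequentially"
      using s(2) \<open>\<delta> > 0\<close> unfolding converges_nearly_uniformly_def by (meson half_gt_zero)
    obtain \<C>' where \<C>': "finite \<C>'" "\<forall>B\<in>\<C>'. brick B" "N \<subseteq> \<Union>\<C>'" "(\<Sum>B\<in>\<C>'. brick_volume B) < \<delta>/2"
      using N(1) \<open>\<delta> > 0\<close> unfolding jordan_null_def by (meson half_gt_zero)
    obtain \<C> where \<C>: "finite \<C>" "\<And>B. B \<in> \<C> \<Longrightarrow> brick B \<and> B \<subseteq> T" "\<Union>\<C> = T \<inter> \<Union>\<C>'"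
      "(\<Sum>B\<in>\<C>. brick_volume B) \<le> (\<Sum>B\<in>\<C>'. brick_volume B)"
      using bricks_restrict[OF T \<C>'(1)] \<C>'(2) by metis
    \<comment> \<open>Bricks common to both families count once in the union, so its sum is at most
      the total of the two sums.\<close>
    have "0 \<le> (\<Sum>B\<in>\<B> \<inter> \<C>. brick_volume B)"
      using \<B>(2) by (intro sum_nonneg brick_volume_nonneg) auto
    then have vol: "(\<Sum>B\<in>\<B> \<union> \<C>. brick_volume B) < \<delta>"
      using sum.union_inter[OF \<B>(1) \<C>(1), of brick_volume] \<B>(3) \<C>(4) \<C>'(4) by linarith
    have "uniform_limit (T - \<Union>(\<B> \<union> \<C>)) s f sequentially"
      by (rule uniform_limit_on_subset[OF \<B>(4)]) auto
    moreover have "g x = f x" if "x \<in> T - \<Union>(\<B> \<union> \<C>)" for x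
      using that \<C>(3) \<C>'(3) by (intro N(2)) auto
    ultimately have lim: "uniform_limit (T - \<Union>(\<B> \<union> \<C>)) s g sequentially"
      by (subst uniform_limit_cong'[where g = s and i = f]) auto
    show ?thesis
      using \<B>(1,2) \<C>(1,2) vol lim by (intro exI[of _ "\<B> \<union> \<C>"]) auto
  qed
  then have "converges_nearly_uniformly T s g"
    using s(2) unfolding converges_nearly_uniformly_def by blast
  then show ?thesis
    using s(1) unfolding K_integrable_def by blast
qed

section \<open>Meshes and sets with Jordan null frontier\<close>

text \<open>The half-open cube of side \<open>1 / Suc m\<close> around \<open>x\<close> in the
  integer grid scaled by that side. Cells are the classes of an equivalence relation, so they
  partition the space; \<open>Suc m\<close> keeps the scale positive at
  \<open>m = 0\<close>.\<close>

definition mesh_cell :: "nat \<Rightarrow> real ^ 'n \<Rightarrow> (real ^ 'n) set" where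
  "mesh_cell m x = {y. \<forall>i. \<lfloor>real (Suc m) * y $ i\<rfloor> = \<lfloor>real (Suc m) * x $ i\<rfloor>}"

lemma mesh_cell_self [simp]: "x \<in> mesh_cell m x"
  by (simp add: mesh_cell_def)

lemma mesh_cell_eq: "y \<in> mesh_cell m x \<Longrightarrow> mesh_cell m y = mesh_cell m x"
  by (simp add: mesh_cell_def)

lemma same_floor_close:
  assumes "\<lfloor>real (Suc m) * s\<rfloor> = \<lfloor>real (Suc m) * t\<rfloor>"
  shows "\<bar>s - t\<bar> \<le> 1 / real (Suc m)"
proof -
  have "\<bar>real (Suc m) * s - real (Suc m) * t\<bar> \<le> 1"
    using assms by linarith
  then have "real (Suc m) * \<bar>s - t\<bar> \<le> 1"
    by (simp add: abs_mult flip: right_diff_distrib)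
  then show ?thesis by (simp add: field_simps)
qed

lemma brick_mesh_cell: "brick (mesh_cell m x)"
proof -
  let ?I = "\<lambda>i. {t. \<lfloor>real (Suc m) * t\<rfloor> = \<lfloor>real (Suc m) * x $ i\<rfloor>}"
  have "is_interval (?I i)" for i
    unfolding is_interval_1
  proof clarify
    fix a b t assume "\<lfloor>real (Suc m) * a\<rfloor> = \<lfloor>real (Suc m) * x $ i\<rfloor>"
      "\<lfloor>real (Suc m) * b\<rfloor> = \<lfloor>real (Suc m) * x $ i\<rfloor>" "a \<le> t" "t \<le> b"
    moreover from this have "\<lfloor>real (Suc m) * a\<rfloor> \<le> \<lfloor>real (Suc m) * t\<rfloor>"
      "\<lfloor>real (Suc m) * t\<rfloor> \<le> \<lfloor>real (Suc m) * b\<rfloor>"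
      by (intro floor_mono mult_left_mono; simp)+
    ultimately show "\<lfloor>real (Suc m) * t\<rfloor> = \<lfloor>real (Suc m) * x $ i\<rfloor>" by linarith
  qed
  moreover have "bounded (?I i)" for i
  proof (rule bounded_subset[OF bounded_cball])
    show "?I i \<subseteq> cball (x $ i) (1 / real (Suc m))"
      using same_floor_close by (force simp: dist_real_def abs_minus_commute)
  qed
  moreover have "x $ i \<in> ?I i" for i by simp
  ultimately show ?thesis
    unfolding brick_def mesh_cell_def by (intro exI[of _ ?I]) auto
qed

lemma dist_mesh_cell:
  fixes x :: "real ^ 'n"
  assumes "y \<in> mesh_cell m x"
  shows "dist x y \<le> real CARD('n) / real (Suc m)"
proof -
  have "dist x y \<le> (\<Sum>i\<in>UNIV. \<bar>(x - y) $ i\<bar>)"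
    unfolding dist_norm by (rule norm_le_l1_cart)
  also have "\<dots> \<le> (\<Sum>i\<in>(UNIV::'n set). 1 / real (Suc m))"
  proof (rule sum_mono)
    fix i
    show "\<bar>(x - y) $ i\<bar> \<le> 1 / real (Suc m)"
      using assms same_floor_close[of m "x $ i" "y $ i"] by (simp add: mesh_cell_def)
  qed
  finally show ?thesis by simp
qed

text \<open>The diameter bound does not involve \<open>x\<close>, so one threshold for
  \<open>m\<close> serves all points; uniform convergence relies on this.\<close>

lemma eventually_mesh_cell_subset_ball:
  fixes r :: real
  assumes "r > 0"
  shows "\<forall>\<^sub>F m in sequentially. \<forall>x :: real ^ 'n. mesh_cell m x \<subseteq> ball x r"
proof -
  have "(\<lambda>m. real CARD('n) / real (Suc m)) \<longlonglongrightarrow> 0"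
    by (rule LIMSEQ_Suc[OF lim_const_over_n])
  then have "\<forall>\<^sub>F m in sequentially. real CARD('n) / real (Suc m) < r"
    using assms by (rule order_tendstoD)
  then show ?thesis
    by eventually_elim (use dist_mesh_cell in \<open>fastforce intro: le_less_trans\<close>)
qed

text \<open>Cells are indexed by points of \<open>T\<close>, so every trace is nonempty and hence a
  brick when \<open>T\<close> is one.\<close>

definition mesh :: "(real ^ 'n) set \<Rightarrow> nat \<Rightarrow> (real ^ 'n) set set" where
  "mesh T m = (\<lambda>x. T \<inter> mesh_cell m x) ` T"

text \<open>A cell is determined by its vector of floors, and on a bounded set these vectors range
  over finitely many integer points.\<close>

lemma finite_mesh:
  fixes T :: "(real ^ 'n) set"
  assumes "bounded T"
  shows "finite (mesh T m)"
proof -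
  obtain r where r: "\<And>x. x \<in> T \<Longrightarrow> norm x \<le> r"
    using assms unfolding bounded_iff by blast
  let ?k = "\<lambda>x :: real ^ 'n. \<lambda>i. \<lfloor>real (Suc m) * x $ i\<rfloor>"
  let ?D = "{\<lfloor>- (real (Suc m) * r)\<rfloor>..\<lfloor>real (Suc m) * r\<rfloor>}"
  have "?k ` T \<subseteq> (\<Pi>\<^sub>E i\<in>UNIV. ?D)"
  proof (clarsimp simp: PiE_def)
    fix x i assume "x \<in> T"
    then have "- r \<le> x $ i" "x $ i \<le> r"
      using r[of x] component_le_norm_cart[of x i] by linarith+
    then have "real (Suc m) * (- r) \<le> real (Suc m) * x $ i" "real (Suc m) * x $ i \<le> real (Suc m) * r"
      by (intro mult_left_mono; simp)+
    then show "\<lfloor>- ((1 + real m) * r)\<rfloor> \<le> \<lfloor>(1 + real m) * x $ i\<rfloor> \<and> \<lfloor>(1 + real m) * x $ i\<rfloor> \<le> \<lfloor>(1 + real m) * r\<rfloor>"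
      by (auto intro!: floor_mono)
  qed
  then have "finite (?k ` T)"
    by (rule finite_subset) (simp add: finite_PiE)
  moreover have "mesh T m = (\<lambda>k. {y \<in> T. ?k y = k}) ` ?k ` T"
    unfolding mesh_def mesh_cell_def image_image by (intro image_cong) (auto simp: fun_eq_iff)
  ultimately show ?thesis by simp
qed

lemma brick_mesh:
  assumes "brick T" "P \<in> mesh T m"
  shows "brick P" "P \<subseteq> T"
  using assms brick_Int[OF assms(1) brick_mesh_cell] mesh_cell_self by (fastforce simp: mesh_def)+

lemma mesh_eq_cell:
  assumes "P \<in> mesh T m" "x \<in> P"
  shows "P = T \<inter> mesh_cell m x"
  using assms mesh_cell_eq by (auto simp: mesh_def)

lemma disjoint_mesh: "disjoint (mesh T m)"
  unfolding disjoint_def using mesh_eq_cell by blast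

lemma step_function_sum_indicator:
  assumes "finite \<P>" "\<And>P. P \<in> \<P> \<Longrightarrow> brick P \<and> P \<subseteq> T"
    and g: "\<And>x. x \<in> T \<Longrightarrow> g x = (\<Sum>P\<in>\<P>. c P * indicat_real P x)"
  shows "step_function T g"
proof -
  obtain h where h: "bij_betw h {..<card \<P>} \<P>"
    using ex_bij_betw_nat_finite[OF assms(1)] by (metis atLeast0LessThan)
  have "g x = (\<Sum>j<card \<P>. (c \<circ> h) j * indicat_real (h j) x)" if "x \<in> T" for x
    unfolding g[OF that] o_def by (rule sum.reindex_bij_betw[OF h, symmetric])
  then have "step_representation T g (card \<P>) (c \<circ> h) h"
    unfolding step_representation_def using assms(2) bij_betwE[OF h] by blast
  then show ?thesis
    unfolding step_function_def by blast
qed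

text \<open>A function whose value depends only on the cell of \<open>x\<close> is a combination of
  indicators of mesh members: at \<open>x\<close> all terms vanish except that of its own
  cell.\<close>

lemma step_function_mesh:
  assumes "brick T"
  shows "step_function T (\<lambda>x. c (T \<inter> mesh_cell m x))"
proof (rule step_function_sum_indicator)
  show "finite (mesh T m)"
    by (rule finite_mesh[OF brick_bounded[OF assms]])
  show "brick P \<and> P \<subseteq> T" if "P \<in> mesh T m" for P
    using brick_mesh assms that by blast
  fix x assume "x \<in> T"
  have "(\<Sum>P\<in>mesh T m. c P * indicat_real P x) = (\<Sum>P\<in>{T \<inter> mesh_cell m x}. c P * indicat_real P x)"
  proof (rule sum.mono_neutral_right)
    show "\<forall>P\<in>mesh T m - {T \<inter> mesh_cell m x}. c P * indicat_real P x = 0"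
      using mesh_eq_cell by (fastforce simp: indicator_def)
  qed (use \<open>x \<in> T\<close> \<open>finite (mesh T m)\<close> in \<open>auto simp: mesh_def\<close>)
  then show "c (T \<inter> mesh_cell m x) = (\<Sum>P\<in>mesh T m. c P * indicat_real P x)"
    using \<open>x \<in> T\<close> by simp
qed

section \<open>Open covers of the frontier and uniformly interior points\<close>

lemma jordan_null_open_cover:
  assumes "jordan_null N" "\<delta> > 0"
  obtains \<B> where "finite \<B>" "\<And>B. B \<in> \<B> \<Longrightarrow> brick B \<and> open B" "N \<subseteq> \<Union>\<B>"
    "(\<Sum>B\<in>\<B>. brick_volume B) < \<delta>"
proof -
  obtain \<B> where \<B>: "finite \<B>" "\<And>B. B \<in> \<B> \<Longrightarrow> brick B" "N \<subseteq> \<Union>\<B>" "(\<Sum>B\<in>\<B>. brick_volume B) < \<delta>/2"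
    using assms unfolding jordan_null_def by (meson half_gt_zero)
  \<comment> \<open>The enlargements cost at most \<open>card \<B> * e\<close>, which is below
    \<open>\<delta>/2\<close>; \<open>Suc\<close> avoids division by zero for an empty
    cover.\<close>
  define e where "e = \<delta> / (2 * real (Suc (card \<B>)))"
  have "e > 0"
    using assms(2) by (simp add: e_def)
  then have "\<forall>B\<in>\<B>. \<exists>B'. brick B' \<and> open B' \<and> B \<subseteq> B' \<and> brick_volume B' < brick_volume B + e"
    using brick_open_superset \<B>(2) by meson
  then obtain E where E: "\<And>B. B \<in> \<B> \<Longrightarrow> brick (E B) \<and> open (E B) \<and> B \<subseteq> E B \<and>
      brick_volume (E B) < brick_volume B + e"
    by metis
  have "(\<Sum>B\<in>E ` \<B>. brick_volume B) \<le> (\<Sum>B\<in>\<B>. brick_volume (E B))"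
    unfolding o_def[of brick_volume E, symmetric]
    using E by (intro sum_image_le \<B>(1) brick_volume_nonneg) auto
  also have "\<dots> \<le> (\<Sum>B\<in>\<B>. brick_volume B + e)"
    using E by (intro sum_mono) (meson less_imp_le)
  also have "\<dots> = (\<Sum>B\<in>\<B>. brick_volume B) + card \<B> * e"
    by (simp add: sum.distrib)
  also have "\<dots> < \<delta>"
  proof -
    have "card \<B> * e \<le> Suc (card \<B>) * e"
      using \<open>e > 0\<close> by (intro mult_right_mono) auto
    also have "\<dots> = \<delta>/2"
      by (simp add: e_def field_simps)
    finally show ?thesis using \<B>(4) by linarith
  qed
  finally show ?thesis
    using that[of "E ` \<B>"] \<B> E by blast
qed

text \<open>Openness of the covering bricks is essential: what remains of \<open>closure C\<close>
  is compact and lies in the open set \<open>interior C\<close>, so one radius works for all its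
  points.\<close>

lemma jordan_measurable_uniformly_interior:
  fixes C :: "(real ^ 'n) set"
  assumes "jordan_measurable C" "\<delta> > 0"
  obtains \<B> r where "finite \<B>" "\<And>B. B \<in> \<B> \<Longrightarrow> brick B" "(\<Sum>B\<in>\<B>. brick_volume B) < \<delta>"
    "r > 0" "\<And>x. x \<in> C - \<Union>\<B> \<Longrightarrow> ball x r \<subseteq> C"
proof -
  obtain \<B> where \<B>: "finite \<B>" "\<And>B. B \<in> \<B> \<Longrightarrow> brick B \<and> open B" "frontier C \<subseteq> \<Union>\<B>"
    "(\<Sum>B\<in>\<B>. brick_volume B) < \<delta>"
    using jordan_null_open_cover assms unfolding jordan_measurable_def by metis
  have "compact (closure C - \<Union>\<B>)"
    using assms(1) \<B>(2) by (intro compact_diff open_Union) (auto simp: jordan_measurable_def compact_closure)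
  moreover have "closure C - \<Union>\<B> \<subseteq> interior C"
    using \<B>(3) by (auto simp: frontier_def)
  ultimately obtain r where r: "r > 0" "(\<Union>x\<in>closure C - \<Union>\<B>. ball x r) \<subseteq> interior C"
    using compact_subset_open_imp_ball_epsilon_subset[of "closure C - \<Union>\<B>" "interior C"] by auto
  show ?thesis
  proof (rule that[of \<B> r])
    fix x assume "x \<in> C - \<Union>\<B>"
    then have "x \<in> closure C - \<Union>\<B>"
      using closure_subset by blast
    then show "ball x r \<subseteq> C"
      using r(2) interior_subset by blast
  qed (use \<B> r in auto)
qed

text \<open>Uniform continuity in place of compactness lets one statement serve both (b) and (c): in
  (c) the set need not be closed, but its indicator is constant on it.\<close>

lemma K_integrable_uniformly_continuous_on_jordan_measurable:
  fixes T :: "(real ^ 'n) set" and f :: "real ^ 'n \<Rightarrow> real"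
  assumes T: "brick T" and C: "jordan_measurable C" "C \<subseteq> T"
    and f: "uniformly_continuous_on C f" "\<And>x. x \<in> T - C \<Longrightarrow> f x = 0"
  shows "K_integrable T f"
proof -
  \<comment> \<open>The choice depends on the cell alone, so each \<open>s m\<close> is constant on
    cells. The default 0 is exact at points outside \<open>C\<close>; at points of \<open>C\<close>
    it occurs, once the mesh is fine, only inside the exceptional bricks.\<close>
  define c where "c P = (if P \<subseteq> C then f (SOME y. y \<in> P) else 0)" for P
  define s where "s m x = c (T \<inter> mesh_cell m x)" for m x
  have some: "(SOME y. y \<in> T \<inter> mesh_cell m x) \<in> T \<inter> mesh_cell m x" if "x \<in> T" for m x
    by (rule someI[of _ x]) (use that in simp)
  have "bounded (f ` C)"
    using bounded_uniformly_continuous_image f(1) C(1) unfolding jordan_measurable_def by blast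
  then obtain K where K: "K > 0" "\<And>x. x \<in> C \<Longrightarrow> \<bar>f x\<bar> \<le> K"
    unfolding bounded_pos by auto
  have "\<bar>s m x\<bar> \<le> K" if "x \<in> T" for m x
    using K some[OF that, of m] by (auto simp: s_def c_def subset_iff)
  moreover have "\<exists>\<B>. finite \<B> \<and> (\<forall>B\<in>\<B>. brick B \<and> B \<subseteq> T) \<and> (\<Sum>B\<in>\<B>. brick_volume B) < \<delta> \<and>
        uniform_limit (T - \<Union>\<B>) s f sequentially" if "\<delta> > 0" for \<delta>
  proof -
    obtain \<B>' r where \<B>': "finite \<B>'" "\<And>B. B \<in> \<B>' \<Longrightarrow> brick B" "(\<Sum>B\<in>\<B>'. brick_volume B) < \<delta>"
      and r: "r > 0" "\<And>x. x \<in> C - \<Union>\<B>' \<Longrightarrow> ball x r \<subseteq> C"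
      using jordan_measurable_uniformly_interior[OF C(1) \<open>\<delta> > 0\<close>] by metis
    obtain \<B> where \<B>: "finite \<B>" "\<And>B. B \<in> \<B> \<Longrightarrow> brick B \<and> B \<subseteq> T" "\<Union>\<B> = T \<inter> \<Union>\<B>'"
      "(\<Sum>B\<in>\<B>. brick_volume B) \<le> (\<Sum>B\<in>\<B>'. brick_volume B)"
      using bricks_restrict[OF T \<B>'(1,2)] by metis
    have "uniform_limit (T - \<Union>\<B>) s f sequentially"
    proof (rule uniform_limitI)
      fix e :: real assume "e > 0"
      then obtain d where d: "d > 0" "\<And>x y. x \<in> C \<Longrightarrow> y \<in> C \<Longrightarrow> dist y x < d \<Longrightarrow> dist (f y) (f x) < e"
        using f(1) unfolding uniformly_continuous_on_def by metis
      \<comment> \<open>Radius \<open>r\<close> keeps the cell of a point of \<open>C\<close>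
        outside the bricks within \<open>C\<close>; radius \<open>d\<close> brings the sampled value
        within \<open>e\<close> of \<open>f x\<close>.\<close>
      have "\<forall>\<^sub>F m in sequentially. \<forall>x :: real ^ 'n. mesh_cell m x \<subseteq> ball x (min r d)"
        using r(1) d(1) by (intro eventually_mesh_cell_subset_ball) simp
      then show "\<forall>\<^sub>F m in sequentially. \<forall>x\<in>T - \<Union>\<B>. dist (s m x) (f x) < e"
      proof eventually_elim
        case (elim m)
        show ?case
        proof
          fix x assume x: "x \<in> T - \<Union>\<B>"
          let ?P = "T \<inter> mesh_cell m x"
          have cell: "mesh_cell m x \<subseteq> ball x r" "mesh_cell m x \<subseteq> ball x d"
            using elim[rule_format, of x] by auto
          show "dist (s m x) (f x) < e"
          proof (cases "x \<in> C")
            case True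
            then have P: "?P \<subseteq> C"
              using r(2)[of x] x \<B>(3) cell(1) by blast
            have "(SOME y. y \<in> ?P) \<in> ?P"
              using some x by blast
            then have "(SOME y. y \<in> ?P) \<in> C" "dist (SOME y. y \<in> ?P) x < d"
              using P cell(2) by (auto simp: dist_commute subset_iff)
            then show ?thesis
              using d(2)[OF True] P by (simp add: s_def c_def)
          next
            case False
            then have "\<not> ?P \<subseteq> C"
              using x by auto
            then show ?thesis
              using f(2)[of x] False x \<open>e > 0\<close> by (simp add: s_def c_def)
          qed
        qed
      qed
    qed
    then show ?thesis
      using \<B> \<B>'(3) by (intro exI[of _ \<B>]) auto
  qed
  ultimately have "converges_nearly_uniformly T s f"
    unfolding converges_nearly_uniformly_def by blast
  moreover have "step_function T (s m)" for m
    unfolding s_def by (rule step_function_mesh[OF T])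
  ultimately show ?thesis
    unfolding K_integrable_def by blast
qed

section \<open>Jordan measure\<close>

text \<open>Take the cells inside \<open>A\<close> of one mesh finer than the radius
  \<open>r\<close>. A point of \<open>A\<close> outside the small bricks has its whole cell in
  \<open>A\<close>, so nothing else of \<open>A\<close> is left uncovered.\<close>

lemma jordan_measurable_approximation:
  fixes A :: "(real ^ 'n) set"
  assumes T: "brick T" and A: "A \<subseteq> T" "jordan_measurable A" and "\<delta> > 0"
  obtains \<C> \<B> where "finite \<C>" "\<And>B. B \<in> \<C> \<Longrightarrow> brick B" "disjoint \<C>" "\<Union>\<C> \<subseteq> A"
    "finite \<B>" "\<And>B. B \<in> \<B> \<Longrightarrow> brick B" "(\<Sum>B\<in>\<B>. brick_volume B) < \<delta>" "A \<subseteq> \<Union>\<C> \<union> \<Union>\<B>"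
proof -
  obtain \<B> r where \<B>: "finite \<B>" "\<And>B. B \<in> \<B> \<Longrightarrow> brick B" "(\<Sum>B\<in>\<B>. brick_volume B) < \<delta>"
    and r: "r > 0" "\<And>x. x \<in> A - \<Union>\<B> \<Longrightarrow> ball x r \<subseteq> A"
    using jordan_measurable_uniformly_interior[OF A(2) \<open>\<delta> > 0\<close>] by metis
  obtain m where m: "\<And>x :: real ^ 'n. mesh_cell m x \<subseteq> ball x r"
    using eventually_happens'[OF sequentially_bot eventually_mesh_cell_subset_ball[OF r(1)]] by blast
  define \<C> where "\<C> = {P \<in> mesh T m. P \<subseteq> A}"
  have "A \<subseteq> \<Union>\<C> \<union> \<Union>\<B>"
  proof
    fix x assume x: "x \<in> A"
    show "x \<in> \<Union>\<C> \<union> \<Union>\<B>"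
    proof (cases "x \<in> \<Union>\<B>")
      case False
      then have "T \<inter> mesh_cell m x \<subseteq> A"
        using r(2)[of x] m[of x] x by blast
      then have "T \<inter> mesh_cell m x \<in> \<C>"
        using x A(1) by (auto simp: \<C>_def mesh_def)
      moreover have "x \<in> T \<inter> mesh_cell m x"
        using x A(1) by auto
      ultimately show ?thesis by blast
    qed simp
  qed
  moreover have "disjoint \<C>"
    using disjoint_mesh[of T m] by (auto simp: \<C>_def disjoint_def)
  moreover have "finite \<C>" "\<Union>\<C> \<subseteq> A"
    using finite_mesh[OF brick_bounded[OF T], of m] by (auto simp: \<C>_def)
  moreover have "brick P" if "P \<in> \<C>" for P
    using that brick_mesh(1)[OF T] unfolding \<C>_def by blast
  ultimately show ?thesis
    using \<B> by (intro that[of \<C> \<B>])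
qed

text \<open>Lebesgue measure separates inner sums from outer sums, and the approximation brings both
  within any \<open>\<delta>\<close> of it.\<close>

lemma jordan_measure_eq_measure:
  fixes A :: "(real ^ 'n) set"
  assumes T: "brick T" and A: "A \<subseteq> T" "jordan_measurable A"
  shows "jordan_measure A = measure lebesgue A"
proof -
  have lm: "A \<in> lmeasurable"
    by (rule jordan_measurable_imp_lmeasurable[OF A(2)])
  let ?\<mu> = "measure lebesgue A"
  define In where "In = {(\<Sum>B\<in>\<B>. brick_volume B) | \<B>.
       finite \<B> \<and> (\<forall>B\<in>\<B>. brick B) \<and> disjoint \<B> \<and> \<Union>\<B> \<subseteq> A}"
  define Out where "Out = {(\<Sum>B\<in>\<B>. brick_volume B) | \<B>. finite \<B> \<and> (\<forall>B\<in>\<B>. brick B) \<and> A \<subseteq> \<Union>\<B>}"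
  have vol: "(\<Sum>B\<in>\<C>. brick_volume B) = measure lebesgue (\<Union>\<C>)"
    if "finite \<C>" "\<And>B. B \<in> \<C> \<Longrightarrow> brick B" "disjoint \<C>" for \<C> :: "(real ^ 'n) set set"
  proof -
    have "measure lebesgue (\<Union>\<C>) = (\<Sum>B\<in>\<C>. measure lebesgue B)"
      using that by (intro measure_Union' brick_lmeasurable) (auto simp: disjoint_def pairwise_def disjnt_def)
    also have "\<dots> = (\<Sum>B\<in>\<C>. brick_volume B)"
      using that by (intro sum.cong measure_brick) auto
    finally show ?thesis ..
  qed
  have In_le: "v \<le> ?\<mu>" if v: "v \<in> In" for v
  proof -
    obtain \<C> where \<C>: "v = (\<Sum>B\<in>\<C>. brick_volume B)" "finite \<C>" "\<forall>B\<in>\<C>. brick B" "disjoint \<C>" "\<Union>\<C> \<subseteq> A"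
      using v unfolding In_def by blast
    then show ?thesis
      using vol[of \<C>] measure_mono_fmeasurable[of "\<Union>\<C>" A lebesgue] lm Union_bricks_lmeasurable(1)[of \<C>]
      by auto
  qed
  have le_Out: "?\<mu> \<le> v" if v: "v \<in> Out" for v
  proof -
    obtain \<B> where \<B>: "v = (\<Sum>B\<in>\<B>. brick_volume B)" "finite \<B>" "\<forall>B\<in>\<B>. brick B" "A \<subseteq> \<Union>\<B>"
      using v unfolding Out_def by blast
    then have "?\<mu> \<le> measure lebesgue (\<Union>\<B>)"
      using lm Union_bricks_lmeasurable(1)[of \<B>] by (intro measure_mono_fmeasurable) auto
    then show ?thesis
      using Union_bricks_lmeasurable(2)[of \<B>] \<B> by auto
  qed
  have approx: "\<exists>v\<in>In. \<exists>w\<in>Out. ?\<mu> - \<delta> \<le> v \<and> w \<le> ?\<mu> + \<delta>" if \<delta>: "\<delta> > 0" for \<delta>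
  proof -
    obtain \<C> \<B> where \<C>: "finite \<C>" "\<And>B. B \<in> \<C> \<Longrightarrow> brick B" "disjoint \<C>" "\<Union>\<C> \<subseteq> A"
      and \<B>: "finite \<B>" "\<And>B. B \<in> \<B> \<Longrightarrow> brick B" "(\<Sum>B\<in>\<B>. brick_volume B) < \<delta>"
      and cov: "A \<subseteq> \<Union>\<C> \<union> \<Union>\<B>"
      using jordan_measurable_approximation[OF T A \<delta>] by metis
    \<comment> \<open>The inner family becomes an outer one by adding the small bricks. The two sums
      enclose \<open>measure lebesgue A\<close> and differ by at most \<open>\<delta>\<close>, so
      each is within \<open>\<delta>\<close> of it.\<close>
    let ?v = "\<Sum>B\<in>\<C>. brick_volume B" and ?w = "\<Sum>B\<in>\<C> \<union> \<B>. brick_volume B"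
    have "?v \<in> In"
      using \<C> unfolding In_def by blast
    moreover have "?w \<in> Out"
      using \<C> \<B> cov unfolding Out_def by (intro CollectI exI[of _ "\<C> \<union> \<B>"]) auto
    moreover have "?w \<le> ?v + \<delta>"
    proof -
      have "0 \<le> (\<Sum>B\<in>\<C> \<inter> \<B>. brick_volume B)"
        using \<C>(2) by (intro sum_nonneg brick_volume_nonneg) auto
      then show ?thesis
        using sum.union_inter[OF \<C>(1) \<B>(1), of brick_volume] \<B>(3) by linarith
    qed
    ultimately show ?thesis
      using In_le[of ?v] le_Out[of ?w] by (intro bexI[of _ ?v] bexI[of _ ?w]) auto
  qed
  have "Sup In = ?\<mu>"
  proof (rule cSup_eq_non_empty)
    show "In \<noteq> {}"
      using approx[of 1] by auto
    show "?\<mu> \<le> y" if "\<And>v. v \<in> In \<Longrightarrow> v \<le> y" for y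
      by (rule field_le_epsilon) (use approx that in \<open>smt (verit)\<close>)
  qed (rule In_le)
  moreover have "Inf Out = ?\<mu>"
  proof (rule cInf_eq_non_empty)
    show "Out \<noteq> {}"
      using approx[of 1] by auto
    show "y \<le> ?\<mu>" if "\<And>v. v \<in> Out \<Longrightarrow> y \<le> v" for y
      by (rule field_le_epsilon) (use approx that in \<open>smt (verit)\<close>)
  qed (rule le_Out)
  ultimately show ?thesis
    unfolding jordan_measure_def inner_jordan_content_def outer_jordan_content_def
      In_def[symmetric] Out_def[symmetric] by auto
qed

section \<open>The three claims, assembled from the integral, the sampling argument and the Jordan
  contents\<close>

theorem proposition2p4:
  fixes T :: "(real ^ 'n) set" and f g :: "real ^ 'n \<Rightarrow> real"
  assumes "brick T"
  shows "(K_integrable T f \<and> jordan_ae_on T (\<lambda>x. g x = f x)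
            \<longrightarrow> K_integrable T g \<and> K_integral T g = K_integral T f) \<and>
         (\<forall>C. compact C \<and> jordan_measurable C \<and> C \<subseteq> T \<and> continuous_on C f \<and> (\<forall>x\<in>T - C. f x = 0)
            \<longrightarrow> K_integrable T f) \<and>
         (\<forall>A. A \<subseteq> T \<and> jordan_measurable A
            \<longrightarrow> K_integrable T (indicat_real A) \<and> K_integral T (indicat_real A) = jordan_measure A)"
proof (intro conjI impI allI; elim conjE)
  assume f: "K_integrable T f" and ae: "jordan_ae_on T (\<lambda>x. g x = f x)"
  show "K_integrable T g"
    using K_integrable_ae_cong[OF assms f ae] .
  obtain N where N: "jordan_null N" "\<And>x. x \<in> T - N \<Longrightarrow> g x = f x"
    using ae unfolding jordan_ae_on_def by blast
  \<comment> \<open>Equality of the values reduces to the insensitivity of the ordinary integral to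
    a negligible set.\<close>
  have "integral T g = integral T f"
    by (rule integral_spike[OF jordan_null_imp_negligible[OF N(1)], symmetric]) (simp add: N(2))
  then show "K_integral T g = K_integral T f"
    using K_integral_eq_integral assms f \<open>K_integrable T g\<close> by metis
next
  fix C
  assume "compact C" "jordan_measurable C" "C \<subseteq> T" "continuous_on C f" "\<forall>x\<in>T - C. f x = 0"
  then show "K_integrable T f"
    using K_integrable_uniformly_continuous_on_jordan_measurable[OF assms] compact_uniformly_continuous
    by blast
next
  fix A assume A: "A \<subseteq> T" "jordan_measurable A"
  \<comment> \<open>The indicator is constantly 1 on \<open>A\<close>, so any positive modulus
    works, for instance 1.\<close>
  have "uniformly_continuous_on A (indicat_real A)"
    by (auto simp: uniformly_continuous_on_def intro: zero_less_one)
  then show "K_integrable T (indicat_real A)"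
    using A by (intro K_integrable_uniformly_continuous_on_jordan_measurable[OF assms]) auto
  moreover have "integral T (indicat_real A) = measure lebesgue A"
    using integral_indicator[of A T] jordan_measurable_imp_lmeasurable[OF A(2)] A(1)
    by (simp add: Int_absorb2)
  ultimately show "K_integral T (indicat_real A) = jordan_measure A"
    using K_integral_eq_integral[OF assms] jordan_measure_eq_measure[OF assms A] by simp
qed

end
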